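(* Let $r>0$, let $S(r)=\sum_{m=1}^{\infty}\frac{2m}{(m^2+r^2)^2}$ be the Mathieu series, and for $\Re x>\frac12$ let $CF(r;x)$ be the continued fraction $$CF(r;x)=\frac{1}{\left(x-\frac 12\right)^2+\frac 14\left(1+4r^2\right)+\mathbf{K}_{n=1}^{\infty}\left(\frac{\kappa_n}{\left(x-\frac 12\right)^2+\lambda_n}\right)},$$ where for $n\ge 1$ $$\kappa_n=-\frac{n^4\left(n^2+4r^2\right)}{4(2n-1)(2n+1)},\qquad \lambda_n=\frac14\left(2n^2+2n+1+4r^2\right).$$ Then for every positive integer $k$, $$S(r)=\sum_{m=1}^{k-1}\frac{2m}{\left(m^2+r^2\right)^2}+CF(r;k),$$ where for $k=1$ the (empty) sum is zero. In particular, $S(r)=CF(r;1)$.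
   Context: For sequences $(a_n)_{n\ge1}$, $(b_n)_{n\ge0}$ of complex numbers with $a_n\ne0$ for all $n$, the generalized continued fraction $$b_0+\mathbf{K}_{n=1}^{\infty}\left(\frac{a_n}{b_n}\right)=b_0+\cfrac{a_1}{b_1+\cfrac{a_2}{b_2+\cdots}}$$ is defined as the limit, as $n\to\infty$, of its $n$th approximants $b_0+\mathbf{K}_{k=1}^{n}\left(\frac{a_k}{b_k}\right)=b_0+\cfrac{a_1}{b_1+\cfrac{a_2}{b_2+\cdots+\cfrac{a_n}{b_n}}}$. Accordingly, $CF(r;x)$ is the limit as $N\to\infty$ of the finite continued fractions obtained by truncating $\mathbf{K}_{n=1}^{\infty}$ to $\mathbf{K}_{n=1}^{N}$; the identity includes the assertion that this limit exists. *)

theory Defs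
  imports Complex_Main
begin

text \<open>The finite continued fraction
  \<open>K\<^bsub>n=m\<^esub>\<^bsup>m+N-1\<^esup> (a\<^sub>n / b\<^sub>n)\<close>, with \<open>N\<close> partial quotients
  starting at index \<open>m\<close>, so that \<open>K\<^bsub>n=1\<^esub>\<^bsup>N\<^esup> (a\<^sub>n / b\<^sub>n)\<close> is \<open>cf_fin a b 1 N\<close>.\<close>

primrec cf_fin :: "(nat \<Rightarrow> complex) \<Rightarrow> (nat \<Rightarrow> complex) \<Rightarrow> nat \<Rightarrow> nat \<Rightarrow> complex" where
  "cf_fin a b m 0 = 0"
| "cf_fin a b m (Suc N) = a m / (b m + cf_fin a b (Suc m) N)"

text \<open>Since \<open>z / 0 = 0\<close> in HOL, \<open>cf_fin\<close> is total; it is the intended nested fraction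
  only if none of the denominators occurring in it vanishes.\<close>

primrec cf_fin_defined :: "(nat \<Rightarrow> complex) \<Rightarrow> (nat \<Rightarrow> complex) \<Rightarrow> nat \<Rightarrow> nat \<Rightarrow> bool" where
  "cf_fin_defined a b m 0 \<longleftrightarrow> True"
| "cf_fin_defined a b m (Suc N) \<longleftrightarrow>
     cf_fin_defined a b (Suc m) N \<and> b m + cf_fin a b (Suc m) N \<noteq> 0"

definition mathieu_term :: "real \<Rightarrow> nat \<Rightarrow> real" where
  "mathieu_term r m = 2 * real m / ((real m)\<^sup>2 + r\<^sup>2)\<^sup>2"

definition mathieu_S :: "real \<Rightarrow> real" where
  "mathieu_S r = (\<Sum>m. mathieu_term r (Suc m))"

definition kappa :: "real \<Rightarrow> nat \<Rightarrow> real" where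
  "kappa r n = - (real n ^ 4 * ((real n)\<^sup>2 + 4 * r\<^sup>2))
                 / (4 * (2 * real n - 1) * (2 * real n + 1))"

definition lambda :: "real \<Rightarrow> nat \<Rightarrow> real" where
  "lambda r n = (2 * (real n)\<^sup>2 + 2 * real n + 1 + 4 * r\<^sup>2) / 4"

definition CF_num :: "real \<Rightarrow> nat \<Rightarrow> complex" where
  "CF_num r n = of_real (kappa r n)"

definition CF_den :: "real \<Rightarrow> complex \<Rightarrow> nat \<Rightarrow> complex" where
  "CF_den r x n = (x - 1/2)\<^sup>2 + of_real (lambda r n)"

definition CF_outer_den :: "real \<Rightarrow> complex \<Rightarrow> nat \<Rightarrow> complex" where
  "CF_outer_den r x N =
     (x - 1/2)\<^sup>2 + of_real ((1 + 4 * r\<^sup>2) / 4) + cf_fin (CF_num r) (CF_den r x) 1 N"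

definition CF_approx :: "real \<Rightarrow> complex \<Rightarrow> nat \<Rightarrow> complex" where
  "CF_approx r x N = 1 / CF_outer_den r x N"

definition CF_approx_defined :: "real \<Rightarrow> complex \<Rightarrow> nat \<Rightarrow> bool" where
  "CF_approx_defined r x N \<longleftrightarrow>
     cf_fin_defined (CF_num r) (CF_den r x) 1 N \<and> CF_outer_den r x N \<noteq> 0"

text \<open>\<open>CF r x\<close> is meaningful only if \<open>CF_convergent r x\<close> holds; the continued fraction
  is considered for \<open>Re x > 1/2\<close>.\<close>

definition CF_convergent :: "real \<Rightarrow> complex \<Rightarrow> bool" where
  "CF_convergent r x \<longleftrightarrow>
     eventually (CF_approx_defined r x) sequentially \<and> convergent (CF_approx r x)"

definition CF :: "real \<Rightarrow> complex \<Rightarrow> complex" where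
  "CF r x = lim (CF_approx r x)"

end

theory Submission
  imports Defs
begin

text \<open>
  For real \<open>x \<ge> 1\<close> all tails of the finite continued fractions are positive, so the approximants
  \<open>F\<^sub>N(x)\<close> increase to a limit \<open>F(x)\<close> of size \<open>O(1/x\<^sup>2)\<close>. Their denominators \<open>q\<^sub>n\<close> are Wilson
  polynomials in \<open>(x - 1/2)\<^sup>2\<close>, and \<open>(x\<^sup>2 + r\<^sup>2)\<^sup>2 q\<^sub>n(x + 1)\<close> is an explicit combination of
  \<open>q\<^sub>n(x)\<close> and \<open>q\<^sub>n\<^sub>-\<^sub>1(x)\<close>; a similar relation holds for the numerators. Hence, with \<open>n = N + 1\<close>,
  \<open>F\<^sub>N(x) - F\<^sub>N(x + 1)\<close> differs from \<open>2x / (x\<^sup>2 + r\<^sup>2)\<^sup>2\<close> by an explicit multiple of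
  \<open>(2n + 1) \<Prod>\<^sub>i\<^sub>\<le>\<^sub>n (-\<kappa>\<^sub>i) / (q\<^sub>n(x) q\<^sub>n(x + 1))\<close>, which is \<open>O(1/n)\<close>. In the limit
  \<open>F(x) - F(x + 1) = 2x / (x\<^sup>2 + r\<^sup>2)\<^sup>2\<close>, and telescoping gives the theorem.
\<close>

text \<open>At \<open>n = 0\<close> this is the outer denominator, since \<open>lambda r 0\<close>
  equals \<open>(1 + 4 * r\<^sup>2) / 4\<close>, so one recurrence covers the whole
  fraction.\<close>

definition cf_d :: "real \<Rightarrow> real \<Rightarrow> nat \<Rightarrow> real" where
  "cf_d r x n = (x - 1/2)\<^sup>2 + lambda r n"

definition solves :: "real \<Rightarrow> real \<Rightarrow> (nat \<Rightarrow> real) \<Rightarrow> bool" where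
  "solves r x y \<longleftrightarrow>
     (\<forall>n. y (Suc (Suc n)) = cf_d r x (Suc n) * y (Suc n) + kappa r (Suc n) * y n)"

text \<open>The index is off by one: the \<open>N\<close>-th approximant is
  \<open>cf_p r x (Suc N) / cf_q r x (Suc N)\<close>.\<close>

fun cf_p :: "real \<Rightarrow> real \<Rightarrow> nat \<Rightarrow> real" where
  "cf_p r x 0 = 0"
| "cf_p r x (Suc 0) = 1"
| "cf_p r x (Suc (Suc n)) = cf_d r x (Suc n) * cf_p r x (Suc n) + kappa r (Suc n) * cf_p r x n"

fun cf_q :: "real \<Rightarrow> real \<Rightarrow> nat \<Rightarrow> real" where
  "cf_q r x 0 = 1"
| "cf_q r x (Suc 0) = cf_d r x 0"
| "cf_q r x (Suc (Suc n)) = cf_d r x (Suc n) * cf_q r x (Suc n) + kappa r (Suc n) * cf_q r x n"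

primrec cf_tail :: "real \<Rightarrow> real \<Rightarrow> nat \<Rightarrow> nat \<Rightarrow> real" where
  "cf_tail r x n 0 = cf_d r x n"
| "cf_tail r x n (Suc N) = cf_d r x n + kappa r (Suc n) / cf_tail r x (Suc n) N"

lemma solves_cf_p: "solves r x (cf_p r x)"
  and solves_cf_q: "solves r x (cf_q r x)"
  by (simp_all add: solves_def)

lemma quarter_le_square:
  assumes "x \<ge> 1"
  shows "1/4 \<le> (x - 1/2 :: real)\<^sup>2"
  using power_mono[of "1/2" "x - 1/2" 2] assms by (simp add: power_divide)

lemma kappa_nonpos: "n > 0 \<Longrightarrow> kappa r n \<le> 0"
  by (simp add: kappa_def divide_nonpos_pos)

subsection \<open>Positivity of the tails\<close>

definition tail_bound :: "real \<Rightarrow> nat \<Rightarrow> real" where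
  "tail_bound r n = real n * ((real n)\<^sup>2 + 4 * r\<^sup>2) / (2 * (2 * real n + 1))"

definition ratio_bound :: "nat \<Rightarrow> real" where
  "ratio_bound n = (real n + 1) ^ 3 / (2 * (2 * real n + 1))"

lemma kappa_Suc_factor: "kappa r (Suc n) = - tail_bound r (Suc n) * ratio_bound n"
proof -
  have nz: "2 * real n + 3 > 0" "2 * real n + 1 > 0" by simp_all
  show ?thesis
    unfolding kappa_def tail_bound_def ratio_bound_def using nz
    by (simp add: divide_simps add_eq_0_iff) algebra
qed

lemma tail_bound_pos: "n > 0 \<Longrightarrow> tail_bound r n > 0"
  unfolding tail_bound_def by (intro divide_pos_pos mult_pos_pos add_pos_nonneg) auto

lemma ratio_bound_pos: "ratio_bound n > 0"
  unfolding ratio_bound_def by (intro divide_pos_pos) auto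

lemma cf_d_split:
  "cf_d r x n = (x - 1/2)\<^sup>2 - 1/4 + tail_bound r n + ratio_bound n + r\<^sup>2 / (2 * real n + 1)"
proof -
  have nz: "2 * real n + 1 > 0" by simp
  show ?thesis
    unfolding cf_d_def lambda_def tail_bound_def ratio_bound_def using nz
    by (simp add: divide_simps) algebra
qed

text \<open>If the next tail is at least \<open>tail_bound r (Suc n)\<close>, the factorisation of
  \<open>kappa\<close> lets the fraction consume at most \<open>ratio_bound n\<close>; the other
  summands of \<open>cf_d_split\<close> survive.\<close>

lemma cf_tail_ge:
  assumes "x \<ge> 1"
  shows "cf_tail r x n N
           \<ge> (x - 1/2)\<^sup>2 - 1/4 + tail_bound r n + r\<^sup>2 / (2 * real n + 1)"
proof (induction N arbitrary: n)
  case 0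
  then show ?case using ratio_bound_pos[of n] by (simp add: cf_d_split)
next
  case (Suc N)
  define t where "t = cf_tail r x (Suc n) N"
  have b: "tail_bound r (Suc n) \<le> t"
    using Suc.IH[of "Suc n"] quarter_le_square[OF assms]
    unfolding t_def by (smt (verit) divide_nonneg_nonneg of_nat_0_le_iff zero_le_power2)
  have "t > 0" using b tail_bound_pos[of "Suc n" r] by simp
  then have "tail_bound r (Suc n) * ratio_bound n / t \<le> ratio_bound n"
    using b ratio_bound_pos[of n] by (simp add: divide_le_eq mult.commute)
  then show ?case
    by (simp add: cf_d_split[of r x n] kappa_Suc_factor flip: t_def)
qed

lemma cf_tail_pos:
  assumes "x \<ge> 1" "r > 0"
  shows "cf_tail r x n N > 0"
proof -
  \<comment> \<open>At \<open>n = 0\<close> and \<open>x = 1\<close> every other part of the lower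
    bound vanishes, so strictness comes from \<open>r > 0\<close>.\<close>
  have "r\<^sup>2 / (2 * real n + 1) > 0" "tail_bound r n \<ge> 0"
    using assms tail_bound_pos[of n r] by (cases n; simp add: tail_bound_def)+
  then show ?thesis
    using cf_tail_ge[OF assms(1), of r n N] quarter_le_square[OF assms(1)] by linarith
qed

text \<open>As \<open>kappa\<close> is nonpositive, \<open>d + kappa / t\<close> increases with
  \<open>t > 0\<close>, so the decrease caused by one more partial quotient passes outwards.\<close>

lemma cf_tail_antimono:
  assumes "x \<ge> 1" "r > 0"
  shows "cf_tail r x n (Suc N) \<le> cf_tail r x n N"
proof (induction N arbitrary: n)
  case 0
  show ?case
    using cf_tail_pos[OF assms, of "Suc n" 0] kappa_nonpos[of "Suc n" r]
    by (simp add: divide_nonpos_pos)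
next
  case (Suc N)
  have "kappa r (Suc n) / cf_tail r x (Suc n) (Suc N) \<le> kappa r (Suc n) / cf_tail r x (Suc n) N"
    using Suc.IH[of "Suc n"] cf_tail_pos[OF assms] kappa_nonpos[of "Suc n" r]
    by (intro divide_left_mono_neg mult_pos_pos) (auto simp del: cf_tail.simps)
  then show ?case
    by (subst (1 2) cf_tail.simps(2)) linarith
qed

section \<open>Real tails as the complex approximants\<close>

lemma cf_fin_eq_cf_tail:
  "CF_den r (of_real x) n + cf_fin (CF_num r) (CF_den r (of_real x)) (Suc n) N
     = of_real (cf_tail r x n N)"
proof (induction N arbitrary: n)
  case 0
  show ?case by (simp add: CF_den_def cf_d_def)
next
  case (Suc N)
  show ?case
    unfolding cf_fin.simps Suc.IH cf_tail.simps by (simp add: CF_num_def CF_den_def cf_d_def)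
qed

lemma CF_outer_den_eq: "CF_outer_den r (of_real x) N = of_real (cf_tail r x 0 N)"
  using cf_fin_eq_cf_tail[of r x 0 N] by (simp add: CF_outer_den_def CF_den_def lambda_def)

lemma CF_approx_eq: "CF_approx r (of_real x) N = of_real (1 / cf_tail r x 0 N)"
  by (simp add: CF_approx_def CF_outer_den_eq)

lemma cf_fin_defined_of_real:
  assumes "x \<ge> 1" "r > 0"
  shows "cf_fin_defined (CF_num r) (CF_den r (of_real x)) n N"
  using cf_tail_pos[OF assms]
  by (induction N arbitrary: n) (auto simp: cf_fin_eq_cf_tail less_le)

lemma CF_approx_defined_of_real:
  assumes "x \<ge> 1" "r > 0"
  shows "CF_approx_defined r (of_real x) N"
  using cf_fin_defined_of_real[OF assms] cf_tail_pos[OF assms, of 0 N]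
  by (simp add: CF_approx_defined_def CF_outer_den_eq)

subsection \<open>Numerators and denominators of the approximants\<close>

text \<open>A late value is a linear form in \<open>y j\<close> and \<open>y (Suc j)\<close> whose
  coefficients have the tail as ratio. \<open>C\<close> does not depend on \<open>y\<close>, so it
  cancels in \<open>cf_p / cf_q\<close>.\<close>

lemma solves_cf_tail:
  assumes "x \<ge> 1" "r > 0"
  shows "\<exists>C>0. \<forall>y. solves r x y \<longrightarrow>
           y (j + N + 2) = C * (cf_tail r x (Suc j) N * y (Suc j) + kappa r (Suc j) * y j)"
proof (induction N arbitrary: j)
  case 0
  show ?case by (intro exI[of _ 1]) (simp add: solves_def)
next
  case (Suc N)
  define t where "t = cf_tail r x (Suc (Suc j)) N"
  have t: "t > 0" unfolding t_def by (rule cf_tail_pos[OF assms])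
  obtain C where C: "C > 0"
    "\<And>y. solves r x y \<Longrightarrow>
       y (Suc j + N + 2) = C * (t * y (Suc (Suc j)) + kappa r (Suc (Suc j)) * y (Suc j))"
    using Suc.IH[of "Suc j"] unfolding t_def by blast
  have "y (j + Suc N + 2)
          = C * t * (cf_tail r x (Suc j) (Suc N) * y (Suc j) + kappa r (Suc j) * y j)"
    if "solves r x y" for y
  proof -
    have "y (Suc (Suc j)) = cf_d r x (Suc j) * y (Suc j) + kappa r (Suc j) * y j"
      using that by (simp add: solves_def)
    then show ?thesis
      using C(2)[OF that] t by (simp add: field_simps flip: t_def)
  qed
  then show ?case using C(1) t by (intro exI[of _ "C * t"]) auto
qed

lemma cf_tail_eq_quotient:
  assumes "x \<ge> 1" "r > 0"
  shows "1 / cf_tail r x 0 N = cf_p r x (Suc N) / cf_q r x (Suc N)"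
proof (cases N)
  case 0
  then show ?thesis by simp
next
  case (Suc M)
  define t where "t = cf_tail r x (Suc 0) M"
  have t: "t > 0" unfolding t_def by (rule cf_tail_pos[OF assms])
  obtain C where C: "C > 0"
    "\<And>y. solves r x y \<Longrightarrow> y (0 + M + 2) = C * (t * y (Suc 0) + kappa r (Suc 0) * y 0)"
    using solves_cf_tail[OF assms, of 0 M] unfolding t_def by blast
  have p: "cf_p r x (Suc N) = C * t"
    using C(2)[OF solves_cf_p] Suc by simp
  have q: "cf_q r x (Suc N) = C * (t * cf_d r x 0 + kappa r (Suc 0))"
    using C(2)[OF solves_cf_q] Suc by simp
  have tail: "cf_tail r x 0 N = (t * cf_d r x 0 + kappa r (Suc 0)) / t"
    using Suc t by (simp add: add_divide_distrib flip: t_def)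
  show ?thesis unfolding p q tail using C(1) by simp
qed

lemma casoratian:
  "cf_p r x (Suc n) * cf_q r x n - cf_q r x (Suc n) * cf_p r x n = (\<Prod>i=1..n. - kappa r i)"
proof (induction n)
  case 0
  show ?case by simp
next
  case (Suc n)
  have "cf_p r x (Suc (Suc n)) * cf_q r x (Suc n) - cf_q r x (Suc (Suc n)) * cf_p r x (Suc n)
      = - kappa r (Suc n) * (cf_p r x (Suc n) * cf_q r x n - cf_q r x (Suc n) * cf_p r x n)"
    by (simp add: algebra_simps)
  then show ?case by (simp add: Suc.IH)
qed

subsection \<open>The shift from x to x + 1\<close>

definition shift_coeff :: "real \<Rightarrow> real \<Rightarrow> nat \<Rightarrow> real" where
  "shift_coeff r x n = (x\<^sup>2 + r\<^sup>2)\<^sup>2 + 2 * real n * x * (x\<^sup>2 + r\<^sup>2) + 2 * (real n)\<^sup>2 * x\<^sup>2 + real n ^ 3 * x"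

text \<open>For a solution \<open>y\<close>, the last factor equals \<open>\<kappa>\<^sub>n y\<^sub>n\<^sub>-\<^sub>1\<close> when \<open>n > 0\<close>; this form also covers
  \<open>n = 0\<close>.\<close>

definition shift_map :: "real \<Rightarrow> real \<Rightarrow> (nat \<Rightarrow> real) \<Rightarrow> nat \<Rightarrow> real" where
  "shift_map r x y n =
     shift_coeff r x n * y n + 2 * x * (2 * real n + 1) * (y (Suc n) - cf_d r x n * y n)"

text \<open>Comparison of the coefficients of \<open>y n\<close> in \<open>solves_shift_map\<close>,
  with the factor \<open>kappa r (Suc n)\<close> removed.\<close>

lemma shift_coeff_step:
  "shift_coeff r x (Suc (Suc n)) = shift_coeff r x n
     + 2 * x * ((2 * real n + 3) * cf_d r (x + 1) (Suc n) - (2 * real n + 1) * cf_d r x n)"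
  unfolding shift_coeff_def cf_d_def lambda_def
  by (simp add: field_simps power2_eq_square power3_eq_cube)

text \<open>Comparison of the coefficients of \<open>y (Suc n)\<close> in
  \<open>solves_shift_map\<close>.\<close>

lemma shift_coeff_cross:
  "cf_d r (x + 1) (Suc n) * shift_coeff r x (Suc n) + 2 * x * (2 * real n + 1) * kappa r (Suc n)
     = shift_coeff r x (Suc (Suc n)) * cf_d r x (Suc n)
       + 2 * x * (2 * real n + 5) * kappa r (Suc (Suc n))"
proof -
  define m where "m = real n"
  have nz: "2 * m + 1 \<noteq> 0" "2 * m + 3 \<noteq> 0" "2 * m + 5 \<noteq> 0" unfolding m_def by linarith+
  have e: "real (Suc n) = m + 1" "real (Suc (Suc n)) = m + 2" by (simp_all add: m_def)
  \<comment> \<open>The odd factors cancel and leave the common denominator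
    \<open>4 * (2 * m + 3)\<close>, which reduces the claim to a polynomial identity.\<close>
  have k1: "(2 * m + 1) * kappa r (Suc n) = - ((m + 1) ^ 4 * ((m + 1)\<^sup>2 + 4 * r\<^sup>2)) / (4 * (2 * m + 3))"
    unfolding kappa_def e using nz by (simp add: divide_simps) algebra
  have k2: "(2 * m + 5) * kappa r (Suc (Suc n)) = - ((m + 2) ^ 4 * ((m + 2)\<^sup>2 + 4 * r\<^sup>2)) / (4 * (2 * m + 3))"
    unfolding kappa_def e using nz by (simp add: divide_simps) algebra
  have "(cf_d r (x + 1) (Suc n) * shift_coeff r x (Suc n)
          - shift_coeff r x (Suc (Suc n)) * cf_d r x (Suc n)) * (4 * (2 * m + 3))
      = 2 * x * ((m + 1) ^ 4 * ((m + 1)\<^sup>2 + 4 * r\<^sup>2) - (m + 2) ^ 4 * ((m + 2)\<^sup>2 + 4 * r\<^sup>2))"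
    unfolding shift_coeff_def cf_d_def lambda_def e by algebra
  then have "cf_d r (x + 1) (Suc n) * shift_coeff r x (Suc n)
          - shift_coeff r x (Suc (Suc n)) * cf_d r x (Suc n)
      = 2 * x * ((2 * m + 5) * kappa r (Suc (Suc n)) - (2 * m + 1) * kappa r (Suc n))"
    unfolding k1 k2 using nz by (simp add: divide_simps)
  then show ?thesis unfolding m_def by (simp add: algebra_simps)
qed

lemma solves_shift_map:
  assumes "solves r x y"
  shows "solves r (x + 1) (shift_map r x y)"
  unfolding solves_def
proof
  fix n
  have y2: "y (Suc (Suc n)) = cf_d r x (Suc n) * y (Suc n) + kappa r (Suc n) * y n"
    and y3: "y (Suc (Suc (Suc n)))
               = cf_d r x (Suc (Suc n)) * y (Suc (Suc n)) + kappa r (Suc (Suc n)) * y (Suc n)"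
    using assms by (simp_all add: solves_def)
  have s2: "shift_map r x y (Suc (Suc n)) = shift_coeff r x (Suc (Suc n)) * y (Suc (Suc n))
      + 2 * x * (2 * real n + 5) * (kappa r (Suc (Suc n)) * y (Suc n))"
    and s1: "shift_map r x y (Suc n) = shift_coeff r x (Suc n) * y (Suc n)
      + 2 * x * (2 * real n + 3) * (kappa r (Suc n) * y n)"
    unfolding shift_map_def y3 y2 by (simp_all add: algebra_simps)
  show "shift_map r x y (Suc (Suc n))
      = cf_d r (x + 1) (Suc n) * shift_map r x y (Suc n) + kappa r (Suc n) * shift_map r x y n"
    unfolding s1 s2 unfolding shift_map_def y2
    using shift_coeff_step[of r x n] shift_coeff_cross[of r x n] by algebra
qed

lemma solves_unique:
  assumes "solves r x y" "solves r x y'" "y 0 = y' 0" "y (Suc 0) = y' (Suc 0)"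
  shows "y n = y' n"
proof (induction n rule: less_induct)
  case (less n)
  consider "n = 0" | "n = Suc 0" | m where "n = Suc (Suc m)"
    by (metis not0_implies_Suc)
  then show ?case
    by cases (use assms less in \<open>auto simp: solves_def\<close>)
qed

lemma cf_q_shift: "(x\<^sup>2 + r\<^sup>2)\<^sup>2 * cf_q r (x + 1) n = shift_map r x (cf_q r x) n"
proof (rule solves_unique[where y = "\<lambda>n. (x\<^sup>2 + r\<^sup>2)\<^sup>2 * cf_q r (x + 1) n"])
  show "solves r (x + 1) (\<lambda>n. (x\<^sup>2 + r\<^sup>2)\<^sup>2 * cf_q r (x + 1) n)"
    by (simp add: solves_def algebra_simps)
  show "solves r (x + 1) (shift_map r x (cf_q r x))"
    by (rule solves_shift_map[OF solves_cf_q])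
  show "(x\<^sup>2 + r\<^sup>2)\<^sup>2 * cf_q r (x + 1) 0 = shift_map r x (cf_q r x) 0"
    by (simp add: shift_map_def shift_coeff_def)
  show "(x\<^sup>2 + r\<^sup>2)\<^sup>2 * cf_q r (x + 1) (Suc 0) = shift_map r x (cf_q r x) (Suc 0)"
    by (simp add: shift_map_def shift_coeff_def cf_d_def lambda_def kappa_def field_simps
        power2_eq_square)
qed

text \<open>The term with \<open>cf_q\<close> is forced at \<open>n = 0\<close>, where
  \<open>shift_map\<close> of \<open>cf_p\<close> equals \<open>2 * x\<close>; it is the source of
  the Mathieu term.\<close>

lemma cf_p_shift:
  "(x\<^sup>2 + r\<^sup>2)\<^sup>2 * cf_p r (x + 1) n + 2 * x * cf_q r (x + 1) n = shift_map r x (cf_p r x) n"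
proof (rule solves_unique[where
      y = "\<lambda>n. (x\<^sup>2 + r\<^sup>2)\<^sup>2 * cf_p r (x + 1) n + 2 * x * cf_q r (x + 1) n"])
  show "solves r (x + 1) (\<lambda>n. (x\<^sup>2 + r\<^sup>2)\<^sup>2 * cf_p r (x + 1) n + 2 * x * cf_q r (x + 1) n)"
    by (simp add: solves_def algebra_simps)
  show "solves r (x + 1) (shift_map r x (cf_p r x))"
    by (rule solves_shift_map[OF solves_cf_p])
  show "(x\<^sup>2 + r\<^sup>2)\<^sup>2 * cf_p r (x + 1) 0 + 2 * x * cf_q r (x + 1) 0 = shift_map r x (cf_p r x) 0"
    by (simp add: shift_map_def)
  show "(x\<^sup>2 + r\<^sup>2)\<^sup>2 * cf_p r (x + 1) (Suc 0) + 2 * x * cf_q r (x + 1) (Suc 0)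
      = shift_map r x (cf_p r x) (Suc 0)"
    by (simp add: shift_map_def shift_coeff_def cf_d_def lambda_def field_simps power2_eq_square)
qed

text \<open>Once both shift relations are inserted, the \<open>shift_coeff\<close> terms cancel and
  a multiple of the Casoratian remains.\<close>

lemma cross_difference:
  "(x\<^sup>2 + r\<^sup>2)\<^sup>2 * (cf_p r x n * cf_q r (x + 1) n - cf_p r (x + 1) n * cf_q r x n)
     = 2 * x * (cf_q r x n * cf_q r (x + 1) n - (2 * real n + 1) * (\<Prod>i=1..n. - kappa r i))"
  unfolding casoratian[of r x n, symmetric]
  using cf_q_shift[of x r n] cf_p_shift[of x r n]
  unfolding shift_map_def by algebra

subsection \<open>Growth of the denominators\<close>

text \<open>Ratios of successive denominators obey \<open>\<rho>' = d + kappa / \<rho>\<close>,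
  which increases with \<open>\<rho> > 0\<close>, so a lower bound \<open>h\<close>
  propagates.\<close>

lemma cf_q_growth:
  assumes h: "\<And>n. h n > 0" "h 0 \<le> cf_d r x 0"
    and step: "\<And>n. h (Suc n) \<le> cf_d r x (Suc n) + kappa r (Suc n) / h n"
  shows "cf_q r x n \<ge> (\<Prod>i<n. h i)"
proof -
  have "cf_q r x n > 0 \<and> cf_q r x (Suc n) \<ge> h n * cf_q r x n" for n
  proof (induction n)
    case 0
    show ?case using h by simp
  next
    case (Suc n)
    have pos: "cf_q r x (Suc n) > 0"
      using Suc h(1)[of n] by (meson less_le_trans mult_pos_pos)
    have "kappa r (Suc n) * cf_q r x n = kappa r (Suc n) / h n * (h n * cf_q r x n)"
      using h(1)[of n] by simp
    also have "\<dots> \<ge> kappa r (Suc n) / h n * cf_q r x (Suc n)"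
      using Suc h(1)[of n] kappa_nonpos[of "Suc n" r]
      by (intro mult_left_mono_neg) (auto simp: divide_nonpos_pos)
    finally have "cf_q r x (Suc (Suc n))
        \<ge> (cf_d r x (Suc n) + kappa r (Suc n) / h n) * cf_q r x (Suc n)"
      by (simp add: algebra_simps)
    moreover have "h (Suc n) * cf_q r x (Suc n)
        \<le> (cf_d r x (Suc n) + kappa r (Suc n) / h n) * cf_q r x (Suc n)"
      using step[of n] pos by (intro mult_right_mono) auto
    ultimately show ?case using pos by linarith
  qed
  note * = this
  show ?thesis
  proof (induction n)
    case (Suc n)
    have "(\<Prod>i<Suc n. h i) \<le> h n * cf_q r x n"
      using Suc.IH h(1)[of n] by (simp add: mult.commute)
    then show ?case using *[of n] by linarith
  qed simp
qed

text \<open>The factorisation of \<open>kappa\<close> read the other way: division by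
  \<open>ratio_bound n\<close> leaves \<open>- tail_bound r (Suc n)\<close>, which
  \<open>cf_d_split\<close> absorbs.\<close>

lemma cf_q_ge:
  assumes "x \<ge> 1"
  shows "cf_q r x n \<ge> (\<Prod>i<n. ratio_bound i)"
proof (rule cf_q_growth[OF ratio_bound_pos])
  show "ratio_bound 0 \<le> cf_d r x 0"
    using quarter_le_square[OF assms]
    by (simp add: cf_d_split tail_bound_def) (use zero_le_power2[of r] in linarith)
  fix n
  have "kappa r (Suc n) / ratio_bound n = - tail_bound r (Suc n)"
    using ratio_bound_pos[of n] by (simp add: kappa_Suc_factor)
  moreover have "r\<^sup>2 / (2 * real (Suc n) + 1) \<ge> 0" by simp
  ultimately show "ratio_bound (Suc n) \<le> cf_d r x (Suc n) + kappa r (Suc n) / ratio_bound n"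
    using quarter_le_square[OF assms] unfolding cf_d_split by linarith
qed

text \<open>The extra factor \<open>n + 1\<close> at the shifted point \<open>x + 1 \<ge> 2\<close> is what forces convergence: the
  bound for \<open>x \<ge> 1\<close> alone only gives a bounded error. The comparison ratios are chosen so that the
  quotients \<open>(i + 2) / (i + 1)\<close> telescope.\<close>

lemma cf_q_ge':
  assumes "x \<ge> 2"
  shows "cf_q r x n \<ge> (real n + 1) * (\<Prod>i<n. ratio_bound i)"
proof -
  define h where "h i = ratio_bound i * ((real i + 2) / (real i + 1))" for i
  have h_pos: "h i > 0" for i
    unfolding h_def using ratio_bound_pos by (intro mult_pos_pos) auto
  have x: "(x - 1/2)\<^sup>2 \<ge> 9/4"
    using power_mono[of "3/2" "x - 1/2" 2] assms by (simp add: power_divide)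
  have "cf_q r x n \<ge> (\<Prod>i<n. h i)"
  proof (rule cf_q_growth[OF h_pos])
    show "h 0 \<le> cf_d r x 0"
      using x by (simp add: h_def ratio_bound_def cf_d_def lambda_def add_divide_distrib)
        (use zero_le_power2[of r] in linarith)
    fix n
    define m where "m = real n + 1"
    have m: "m \<ge> 1" by (simp add: m_def)
    have "- kappa r (Suc n) / h n = m\<^sup>2 * (m\<^sup>2 + 4 * r\<^sup>2) / (2 * (2 * m + 1) * (m + 1))"
    proof -
      have "h n = m\<^sup>2 * (m + 1) / (2 * (2 * m - 1))"
        unfolding h_def ratio_bound_def m_def
        by (simp add: divide_simps power2_eq_square power3_eq_cube) algebra
      moreover have "- kappa r (Suc n) = (m ^ 4 * (m\<^sup>2 + 4 * r\<^sup>2)) / (4 * (2 * m - 1) * (2 * m + 1))"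
        by (simp add: kappa_def m_def add.commute)
      moreover have "2 * m - 1 > 0" "2 * m + 1 > 0" using m by linarith+
      ultimately have "- kappa r (Suc n) = m\<^sup>2 * (m\<^sup>2 + 4 * r\<^sup>2) / (2 * (2 * m + 1) * (m + 1)) * h n"
        using m by (simp add: divide_simps) algebra
      then show ?thesis using h_pos[of n] by (simp add: divide_eq_eq)
    qed
    moreover have "h (Suc n) = (m + 1)\<^sup>2 * (m + 2) / (2 * (2 * m + 1))"
      unfolding h_def ratio_bound_def m_def
      by (simp add: divide_simps power2_eq_square power3_eq_cube)
    \<comment> \<open>With \<open>9/4\<close> in place of \<open>(x - 1/2)\<^sup>2\<close>, the
      slack in the required inequality has a numerator with only positive coefficients.\<close>
    moreover have "9/4 + lambda r (Suc n) - (m + 1)\<^sup>2 * (m + 2) / (2 * (2 * m + 1))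
        - m\<^sup>2 * (m\<^sup>2 + 4 * r\<^sup>2) / (2 * (2 * m + 1) * (m + 1))
        = (5 * m\<^sup>2 + 9 * m + 3 + 2 * r\<^sup>2 * (3 * m + 1)) / (2 * (2 * m + 1) * (m + 1))"
    proof -
      have "lambda r (Suc n) = (2 * m\<^sup>2 + 2 * m + 1 + 4 * r\<^sup>2) / 4"
        by (simp add: lambda_def m_def add.commute)
      moreover have "2 * m + 1 > 0" "m + 1 > 0" using m by linarith+
      ultimately show ?thesis
        by (simp add: divide_simps) (simp add: algebra_simps power2_eq_square)
    qed
    moreover have "\<dots> \<ge> 0" using m by (intro divide_nonneg_nonneg add_nonneg_nonneg) auto
    ultimately show "h (Suc n) \<le> cf_d r x (Suc n) + kappa r (Suc n) / h n"
      using x unfolding cf_d_def by simp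
  qed
  moreover have "(\<Prod>i<n. h i) = (real n + 1) * (\<Prod>i<n. ratio_bound i)"
    by (induction n) (auto simp: h_def)
  ultimately show ?thesis by simp
qed

section \<open>Size of the Casoratian\<close>

lemma prod_kappa:
  "(2 * real n + 1) * (\<Prod>i=1..n. - kappa r i)
     = (\<Prod>i<n. ratio_bound i)\<^sup>2 * (\<Prod>i=1..n. 1 + 4 * r\<^sup>2 / (real i)\<^sup>2)"
proof (induction n)
  case 0
  show ?case by simp
next
  case (Suc n)
  have "(2 * real (Suc n) + 1) * - kappa r (Suc n)
      = (2 * real n + 1) * ((ratio_bound n)\<^sup>2 * (1 + 4 * r\<^sup>2 / (real (Suc n))\<^sup>2))"
  proof -
    define m where "m = real n"
    have nz: "2 * m + 1 \<noteq> 0" "2 * m + 3 \<noteq> 0" "m + 1 \<noteq> 0" unfolding m_def by linarith+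
    have e: "real (Suc n) = m + 1" by (simp add: m_def)
    show ?thesis
      unfolding kappa_def ratio_bound_def e m_def[symmetric]
      using nz by (simp add: divide_simps) algebra
  qed
  with Suc.IH show ?case by (simp add: power_mult_distrib) algebra
qed

lemma prod_one_plus_inverse_squares_le:
  assumes "c \<ge> 0"
  shows "(\<Prod>i=1..n. 1 + c / (real i)\<^sup>2) \<le> exp (2 * c)"
proof -
  \<comment> \<open>Sharpened for induction: \<open>2 - 2 / (2 * n + 1)\<close> is the telescoping
    sum of \<open>1 / (i - 1/2) - 1 / (i + 1/2)\<close>, whose terms majorise
    \<open>1 / i\<^sup>2\<close>.\<close>
  have "(\<Prod>i=1..n. 1 + c / (real i)\<^sup>2) \<le> exp (c * (2 - 2 / (2 * real n + 1)))"
  proof (induction n)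
    case 0
    show ?case by simp
  next
    case (Suc n)
    define m where "m = real n"
    have m: "m \<ge> 0" by (simp add: m_def)
    have "1 / (m + 1)\<^sup>2 \<le> 2 / (2 * m + 1) - 2 / (2 * m + 3)"
      using m by (simp add: divide_simps) (simp add: algebra_simps power2_eq_square)
    then have le: "c * (1 / (m + 1)\<^sup>2) \<le> c * (2 / (2 * m + 1) - 2 / (2 * m + 3))"
      using assms by (intro mult_left_mono) auto
    have "1 + c / (m + 1)\<^sup>2 \<le> exp (c * (1 / (m + 1)\<^sup>2))"
      using exp_ge_add_one_self[of "c * (1 / (m + 1)\<^sup>2)"] by simp
    also have "\<dots> \<le> exp (c * (2 / (2 * m + 1) - 2 / (2 * m + 3)))"
      using le by simp
    finally have "(\<Prod>i=1..n. 1 + c / (real i)\<^sup>2) * (1 + c / (m + 1)\<^sup>2)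
        \<le> exp (c * (2 - 2 / (2 * m + 1))) * exp (c * (2 / (2 * m + 1) - 2 / (2 * m + 3)))"
      using Suc.IH assms by (intro mult_mono) (auto simp: m_def)
    also have "\<dots> = exp (c * (2 - 2 / (2 * m + 3)))"
      by (simp add: algebra_simps flip: exp_add)
    finally show ?case by (simp add: m_def algebra_simps)
  qed
  also have "\<dots> \<le> exp (2 * c)"
    using assms by (simp add: mult.commute mult_left_mono)
  finally show ?thesis .
qed

subsection \<open>Convergence and telescoping\<close>

lemma approx_difference_tendsto:
  assumes "x \<ge> 1" "r > 0"
  shows "(\<lambda>N. 1 / cf_tail r x 0 N - 1 / cf_tail r (x + 1) 0 N)
           \<longlonglongrightarrow> 2 * x / (x\<^sup>2 + r\<^sup>2)\<^sup>2"
proof -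
  define U where "U = (x\<^sup>2 + r\<^sup>2)\<^sup>2"
  have U: "U > 0" using assms by (simp add: U_def add_pos_pos)
  define B where "B = 2 * x * exp (8 * r\<^sup>2) / U"
  have bound: "norm (1 / cf_tail r x 0 N - 1 / cf_tail r (x + 1) 0 N - 2 * x / U) \<le> B * inverse (real (Suc N))"
    for N
  proof -
    define n where "n = Suc N"
    define R where "R = (\<Prod>i<n. ratio_bound i)"
    define W where "W = (2 * real n + 1) * (\<Prod>i=1..n. - kappa r i)"
    define q where "q = cf_q r x n"
    define q' where "q' = cf_q r (x + 1) n"
    have R: "R > 0" unfolding R_def by (intro prod_pos) (simp add: ratio_bound_pos)
    have q: "q \<ge> R" unfolding q_def R_def by (rule cf_q_ge[OF assms(1)])
    have "q' \<ge> (real n + 1) * R" unfolding q'_def R_def using assms by (intro cf_q_ge') auto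
    then have q': "q' \<ge> real n * R" using R by (simp add: algebra_simps)
    have nR: "real n * R > 0" using R by (simp add: n_def)
    have pos: "q > 0" "q' > 0" using q q' R nR by linarith+
    have W: "W = R\<^sup>2 * (\<Prod>i=1..n. 1 + 4 * r\<^sup>2 / (real i)\<^sup>2)"
      unfolding W_def R_def by (rule prod_kappa)
    have W0: "W \<ge> 0" unfolding W by (intro mult_nonneg_nonneg prod_nonneg) auto
    have "W \<le> R\<^sup>2 * exp (8 * r\<^sup>2)"
      unfolding W using prod_one_plus_inverse_squares_le[of "4 * r\<^sup>2" n]
      by (intro mult_left_mono) auto
    \<comment> \<open>\<open>W\<close> is of order \<open>R\<^sup>2\<close>, while \<open>q\<close>
      contributes \<open>R\<close> and \<open>q'\<close> contributes \<open>n * R\<close>, which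
      leaves \<open>1 / n\<close>.\<close>
    then have "W / (q * q') \<le> R\<^sup>2 * exp (8 * r\<^sup>2) / (R * (real n * R))"
      using q q' R nR pos by (intro frac_le mult_mono) auto
    also have "\<dots> = exp (8 * r\<^sup>2) * inverse (real n)"
      using R by (simp add: divide_simps power2_eq_square)
    finally have le: "W / (q * q') \<le> exp (8 * r\<^sup>2) * inverse (real n)" .
    have "U * (cf_p r x n * q' - cf_p r (x + 1) n * q) = 2 * x * (q * q' - W)"
      unfolding U_def q_def q'_def W_def by (rule cross_difference)
    moreover have "cf_p r x n / q - cf_p r (x + 1) n / q'
        = U * (cf_p r x n * q' - cf_p r (x + 1) n * q) / (U * (q * q'))"
      using pos U by (simp add: diff_frac_eq)
    ultimately have "cf_p r x n / q - cf_p r (x + 1) n / q' = 2 * x * (q * q' - W) / (U * (q * q'))"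
      by simp
    then have "cf_p r x n / q - cf_p r (x + 1) n / q' - 2 * x / U = - (2 * x / U * (W / (q * q')))"
      using pos U by (simp add: divide_simps) (simp add: algebra_simps)
    then have "1 / cf_tail r x 0 N - 1 / cf_tail r (x + 1) 0 N - 2 * x / U
        = - (2 * x / U * (W / (q * q')))"
      using assms by (simp add: cf_tail_eq_quotient q_def q'_def n_def)
    moreover have "2 * x / U * (W / (q * q')) \<ge> 0"
      using assms U W0 pos by simp
    moreover have "2 * x / U * (W / (q * q')) \<le> 2 * x / U * (exp (8 * r\<^sup>2) * inverse (real n))"
      using assms U le by (intro mult_left_mono) auto
    ultimately show ?thesis by (simp add: B_def n_def)
  qed
  have "(\<lambda>N. B * inverse (real (Suc N))) \<longlonglongrightarrow> 0"
    using tendsto_mult_left[OF LIMSEQ_inverse_real_of_nat, of B] by simp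
  then have "(\<lambda>N. 1 / cf_tail r x 0 N - 1 / cf_tail r (x + 1) 0 N - 2 * x / U) \<longlonglongrightarrow> 0"
    by (rule tendsto_norm_zero_cancel[OF tendsto_sandwich[OF _ _ tendsto_const], rotated 2])
      (use bound in \<open>auto intro: always_eventually\<close>)
  then show ?thesis unfolding U_def by (rule LIM_zero_cancel)
qed

section \<open>The limit function and its difference equation\<close>

definition cf_lim :: "real \<Rightarrow> real \<Rightarrow> real" where
  "cf_lim r x = lim (\<lambda>N. 1 / cf_tail r x 0 N)"

text \<open>The tail bound at \<open>n = 0\<close>. It bounds the increasing approximants and gives
  the decay in \<open>x\<close> that telescoping needs.\<close>

lemma approx_le:
  assumes "x \<ge> 1" "r > 0"
  shows "1 / cf_tail r x 0 N \<le> 1 / ((x - 1/2)\<^sup>2 - 1/4 + r\<^sup>2)"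
proof (rule divide_left_mono)
  show "(x - 1/2)\<^sup>2 - 1/4 + r\<^sup>2 \<le> cf_tail r x 0 N"
    using cf_tail_ge[OF assms(1), of r 0 N] by (simp add: tail_bound_def)
  have "(x - 1/2)\<^sup>2 - 1/4 + r\<^sup>2 > 0"
    using quarter_le_square[OF assms(1)] assms(2) by (simp add: add_nonneg_pos)
  then show "cf_tail r x 0 N * ((x - 1/2)\<^sup>2 - 1/4 + r\<^sup>2) > 0"
    using cf_tail_pos[OF assms] by simp
qed simp

lemma approx_tendsto:
  assumes "x \<ge> 1" "r > 0"
  shows "(\<lambda>N. 1 / cf_tail r x 0 N) \<longlonglongrightarrow> cf_lim r x"
proof -
  have "incseq (\<lambda>N. 1 / cf_tail r x 0 N)"
    using cf_tail_antimono[OF assms] cf_tail_pos[OF assms]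
    by (intro incseq_SucI divide_left_mono mult_pos_pos) (auto simp del: cf_tail.simps)
  then obtain L where "(\<lambda>N. 1 / cf_tail r x 0 N) \<longlonglongrightarrow> L"
    using approx_le[OF assms] incseq_convergent by metis
  then show ?thesis unfolding cf_lim_def by (simp add: limI)
qed

lemma cf_lim_bounds:
  assumes "x \<ge> 1" "r > 0"
  shows "0 \<le> cf_lim r x" "cf_lim r x \<le> 1 / ((x - 1/2)\<^sup>2 - 1/4 + r\<^sup>2)"
  using cf_tail_pos[OF assms, of 0] approx_le[OF assms]
  by (auto intro!: LIMSEQ_le_const[OF approx_tendsto[OF assms]]
      LIMSEQ_le_const2[OF approx_tendsto[OF assms]] simp: less_imp_le)

lemma cf_lim_difference:
  assumes "x \<ge> 1" "r > 0"
  shows "cf_lim r x - cf_lim r (x + 1) = 2 * x / (x\<^sup>2 + r\<^sup>2)\<^sup>2"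
  by (rule LIMSEQ_unique[OF tendsto_diff approx_difference_tendsto])
    (use assms in \<open>auto intro: approx_tendsto\<close>)

lemma cf_lim_tendsto_0:
  assumes "r > 0"
  shows "(\<lambda>n. cf_lim r (real n + 1)) \<longlonglongrightarrow> 0"
proof (rule tendsto_sandwich[OF _ _ tendsto_const LIMSEQ_inverse_real_of_nat])
  show "\<forall>\<^sub>F n in sequentially. 0 \<le> cf_lim r (real n + 1)"
    using cf_lim_bounds(1) assms by (intro always_eventually) auto
  show "\<forall>\<^sub>F n in sequentially. cf_lim r (real n + 1) \<le> inverse (real (Suc n))"
    \<comment> \<open>At \<open>x = n + 1\<close> the bound has denominator
      \<open>n * (n + 1) + r\<^sup>2\<close>, which is at least \<open>n + 1\<close> once
      \<open>n > 0\<close>.\<close>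
    using eventually_gt_at_top[of 0]
  proof eventually_elim
    case (elim n)
    have "real n * (real n + 1) \<ge> 1 * (real n + 1)"
      using elim by (intro mult_right_mono) auto
    then have "real n + 1 \<le> (real n + 1 - 1/2)\<^sup>2 - 1/4 + r\<^sup>2"
      by (simp add: power2_eq_square algebra_simps) (use zero_le_square[of r] in linarith)
    then have "1 / ((real n + 1 - 1/2)\<^sup>2 - 1/4 + r\<^sup>2) \<le> 1 / (real n + 1)"
      by (intro divide_left_mono mult_pos_pos) linarith+
    then show ?case
      using cf_lim_bounds(2)[of "real n + 1" r] assms
      by (simp add: inverse_eq_divide add.commute)
  qed
qed

lemma mathieu_term_eq_difference:
  assumes "r > 0"
  shows "mathieu_term r (Suc n) = cf_lim r (real n + 1) - cf_lim r (real (Suc n) + 1)"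
  using cf_lim_difference[of "real n + 1" r] assms
  by (simp add: mathieu_term_def algebra_simps)

lemma mathieu_S_eq_cf_lim:
  assumes "r > 0"
  shows "mathieu_S r = cf_lim r 1"
proof -
  have "(\<lambda>n. cf_lim r (real n + 1) - cf_lim r (real (Suc n) + 1)) sums (cf_lim r (real 0 + 1) - 0)"
    by (rule telescope_sums'[OF cf_lim_tendsto_0[OF assms]])
  then show ?thesis
    unfolding mathieu_S_def mathieu_term_eq_difference[OF assms] by (simp add: sums_iff)
qed

lemma sum_mathieu_term:
  assumes "r > 0"
  shows "(\<Sum>m=1..n. mathieu_term r m) = cf_lim r 1 - cf_lim r (real n + 1)"
  by (induction n) (simp_all add: mathieu_term_eq_difference[OF assms])

lemma CF_of_real:
  assumes "x \<ge> 1" "r > 0"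
  shows "CF_convergent r (of_real x)" "CF r (of_real x) = of_real (cf_lim r x)"
proof -
  have "CF_approx r (of_real x) \<longlonglongrightarrow> of_real (cf_lim r x)"
    using tendsto_of_real[OF approx_tendsto[OF assms]] by (simp only: CF_approx_eq[abs_def])
  then show "CF_convergent r (of_real x)" "CF r (of_real x) = of_real (cf_lim r x)"
    using CF_approx_defined_of_real[OF assms]
    by (auto simp: CF_convergent_def CF_def limI convergentI intro!: always_eventually)
qed

theorem theorem1:
  fixes r :: real
  assumes "r > 0"
  shows "(\<forall>k::nat. k \<ge> 1 \<longrightarrow>
            CF_convergent r (of_nat k) \<and>
            complex_of_real (mathieu_S r) =
              complex_of_real (\<Sum>m=1..k-1. mathieu_term r m) + CF r (of_nat k))
         \<and> CF_convergent r 1 \<and> complex_of_real (mathieu_S r) = CF r 1"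
proof -
  have "CF_convergent r (of_nat k) \<and>
      complex_of_real (mathieu_S r) =
        complex_of_real (\<Sum>m=1..k-1. mathieu_term r m) + CF r (of_nat k)"
    if "k \<ge> 1" for k :: nat
  proof -
    have "real (k - 1) + 1 = real k" using that by simp
    then have "mathieu_S r = (\<Sum>m=1..k-1. mathieu_term r m) + cf_lim r (real k)"
      unfolding mathieu_S_eq_cf_lim[OF assms] sum_mathieu_term[OF assms] by simp
    then show ?thesis
      using CF_of_real[of "real k" r] that assms by simp
  qed
  note * = this
  then show ?thesis using *[of 1] by simp
qed

end
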